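(* Let $r_l\in\mathbb{R}$ ($l=0,1,2,\dots$) and $p\in\mathbb{H}$. If the quaternionic power series $\sum_{l=0}^{\infty} r_l p^l$ converges, then $r_l p^l\to 0$ as $l\to\infty$.
   Context: $\mathbb{H}$ is the algebra of quaternions with norm $|p|=\sqrt{x^2+y^2+z^2+u^2}$ for $p=x+yi+zj+uk$. The series $\sum_{l=0}^\infty r_l p^l$ is convergent if the sequence of its partial sums $S_n(p)=\sum_{l=0}^n r_l p^l$ is convergent. *)

theory Defs
  imports "HOL-Analysis.Analysis"
begin

text \<open>
  The real algebra of quaternions: \<open>Quat x y z u\<close> stands for \<open>x + y i + z j + u k\<close>.
  The set-up follows that of the type \<^typ>\<open>complex\<close>.
\<close>

codatatype quat = Quat (Re_q: real) (Im_i: real) (Im_j: real) (Im_k: real)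

lemma quat_eq_iff:
  "p = q \<longleftrightarrow> Re_q p = Re_q q \<and> Im_i p = Im_i q \<and> Im_j p = Im_j q \<and> Im_k p = Im_k q"
  by (auto intro: quat.expand)

instantiation quat :: ab_group_add
begin

primcorec zero_quat where
  "Re_q 0 = 0"
| "Im_i 0 = 0"
| "Im_j 0 = 0"
| "Im_k 0 = 0"

primcorec plus_quat where
  "Re_q (p + q) = Re_q p + Re_q q"
| "Im_i (p + q) = Im_i p + Im_i q"
| "Im_j (p + q) = Im_j p + Im_j q"
| "Im_k (p + q) = Im_k p + Im_k q"

primcorec uminus_quat where
  "Re_q (- p) = - Re_q p"
| "Im_i (- p) = - Im_i p"
| "Im_j (- p) = - Im_j p"
| "Im_k (- p) = - Im_k p"

primcorec minus_quat where
  "Re_q (p - q) = Re_q p - Re_q q"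
| "Im_i (p - q) = Im_i p - Im_i q"
| "Im_j (p - q) = Im_j p - Im_j q"
| "Im_k (p - q) = Im_k p - Im_k q"

instance
  by standard (simp_all add: quat_eq_iff)

end

instantiation quat :: ring_1
begin

primcorec one_quat where
  "Re_q 1 = 1"
| "Im_i 1 = 0"
| "Im_j 1 = 0"
| "Im_k 1 = 0"

primcorec times_quat where
  "Re_q (p * q) = Re_q p * Re_q q - Im_i p * Im_i q - Im_j p * Im_j q - Im_k p * Im_k q"
| "Im_i (p * q) = Re_q p * Im_i q + Im_i p * Re_q q + Im_j p * Im_k q - Im_k p * Im_j q"
| "Im_j (p * q) = Re_q p * Im_j q - Im_i p * Im_k q + Im_j p * Re_q q + Im_k p * Im_i q"
| "Im_k (p * q) = Re_q p * Im_k q + Im_i p * Im_j q - Im_j p * Im_i q + Im_k p * Re_q q"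

instance
  by standard (simp_all add: quat_eq_iff algebra_simps)

end

instantiation quat :: real_algebra_1
begin

primcorec scaleR_quat where
  "Re_q (scaleR r p) = r * Re_q p"
| "Im_i (scaleR r p) = r * Im_i p"
| "Im_j (scaleR r p) = r * Im_j p"
| "Im_k (scaleR r p) = r * Im_k p"

instance
  by standard (simp_all add: quat_eq_iff algebra_simps)

end

instantiation quat :: real_inner
begin

definition norm_quat :: "quat \<Rightarrow> real" where
  "norm p = sqrt ((Re_q p)\<^sup>2 + (Im_i p)\<^sup>2 + (Im_j p)\<^sup>2 + (Im_k p)\<^sup>2)"

definition inner_quat :: "quat \<Rightarrow> quat \<Rightarrow> real" where
  "inner p q = Re_q p * Re_q q + Im_i p * Im_i q + Im_j p * Im_j q + Im_k p * Im_k q"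

definition sgn_quat :: "quat \<Rightarrow> quat" where
  "sgn (p :: quat) = p /\<^sub>R norm p"

definition dist_quat :: "quat \<Rightarrow> quat \<Rightarrow> real" where
  "dist (p :: quat) q = norm (p - q)"

definition uniformity_quat :: "(quat \<times> quat) filter" where
  "uniformity = (INF e\<in>{0 <..}. principal {(p :: quat, q). dist p q < e})"

definition open_quat :: "quat set \<Rightarrow> bool" where
  "open (U :: quat set) \<longleftrightarrow> (\<forall>p\<in>U. eventually (\<lambda>(p', q). p' = p \<longrightarrow> q \<in> U) uniformity)"

instance
proof
  fix p q s :: quat and r :: real
  show "inner p q = inner q p"
    by (simp add: inner_quat_def mult.commute)
  show "inner (p + q) s = inner p s + inner q s"
    by (simp add: inner_quat_def algebra_simps)
  show "inner (scaleR r p) q = r * inner p q"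
    by (simp add: inner_quat_def algebra_simps)
  show "0 \<le> inner p p"
    by (simp add: inner_quat_def)
  show "inner p p = 0 \<longleftrightarrow> p = 0"
    by (simp add: inner_quat_def quat_eq_iff add_nonneg_eq_0_iff)
  show "norm p = sqrt (inner p p)"
    by (simp add: inner_quat_def norm_quat_def power2_eq_square)
qed (rule sgn_quat_def dist_quat_def open_quat_def uniformity_quat_def)+

end

instantiation quat :: real_normed_div_algebra
begin

primcorec inverse_quat where
  "Re_q (inverse p) = Re_q p / (norm p)\<^sup>2"
| "Im_i (inverse p) = - Im_i p / (norm p)\<^sup>2"
| "Im_j (inverse p) = - Im_j p / (norm p)\<^sup>2"
| "Im_k (inverse p) = - Im_k p / (norm p)\<^sup>2"

definition divide_quat :: "quat \<Rightarrow> quat \<Rightarrow> quat" where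
  "(p :: quat) div q = p * inverse q"

instance
proof
  fix p q :: quat
  have norm2: "(norm p)\<^sup>2 = (Re_q p)\<^sup>2 + (Im_i p)\<^sup>2 + (Im_j p)\<^sup>2 + (Im_k p)\<^sup>2" for p :: quat
    by (simp add: norm_quat_def)
  show "inverse p * p = 1" if "p \<noteq> 0"
  proof -
    define n where "n = (norm p)\<^sup>2"
    have "n \<noteq> 0" using that by (simp add: n_def)
    moreover have "n = Re_q p * Re_q p + Im_i p * Im_i p + Im_j p * Im_j p + Im_k p * Im_k p"
      unfolding n_def norm2 by (simp add: power2_eq_square)
    ultimately show ?thesis
      by (simp add: quat_eq_iff n_def [symmetric] diff_divide_distrib [symmetric]
          add_divide_distrib [symmetric] mult.commute)
  qed
  show "p * inverse p = 1" if "p \<noteq> 0"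
  proof -
    define n where "n = (norm p)\<^sup>2"
    have "n \<noteq> 0" using that by (simp add: n_def)
    moreover have "n = Re_q p * Re_q p + Im_i p * Im_i p + Im_j p * Im_j p + Im_k p * Im_k p"
      unfolding n_def norm2 by (simp add: power2_eq_square)
    ultimately show ?thesis
      by (simp add: quat_eq_iff n_def [symmetric] diff_divide_distrib [symmetric]
          add_divide_distrib [symmetric] mult.commute)
  qed
  show "(p :: quat) div q = p * inverse q"
    by (rule divide_quat_def)
  show "inverse (0 :: quat) = 0"
    by (simp add: quat_eq_iff)
  show "norm (p * q) = norm p * norm q"
    unfolding norm_quat_def
    by (simp add: real_sqrt_mult [symmetric] power2_eq_square algebra_simps)
qed

end

definition quat_i :: quat where "quat_i = Quat 0 1 0 0"
definition quat_j :: quat where "quat_j = Quat 0 0 1 0"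
definition quat_k :: quat where "quat_k = Quat 0 0 0 1"

lemma quat_units:
  "quat_i * quat_i = - 1" "quat_j * quat_j = - 1" "quat_k * quat_k = - 1"
  "quat_i * quat_j = quat_k" "quat_j * quat_k = quat_i" "quat_k * quat_i = quat_j"
  "quat_j * quat_i = - quat_k" "quat_k * quat_j = - quat_i" "quat_i * quat_k = - quat_j"
  by (simp_all add: quat_eq_iff quat_i_def quat_j_def quat_k_def)

lemma Quat_eq:
  "Quat x y z u = of_real x + of_real y * quat_i + of_real z * quat_j + of_real u * quat_k"
  by (simp add: quat_eq_iff of_real_def quat_i_def quat_j_def quat_k_def)

end

theory Submission
  imports Defs
begin

text \<open>Each term with l > 0 is the difference of two consecutive partial sums; these have the
  same limit, so the terms tend to 0. This holds in any real normed vector space, where it is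
  \<open>summable_LIMSEQ_zero\<close>.\<close>

theorem proposition3p5:
  fixes r :: "nat \<Rightarrow> real" and p :: quat
  assumes "convergent (\<lambda>n. \<Sum>l=0..n. of_real (r l) * p ^ l)"
  shows "(\<lambda>l. of_real (r l) * p ^ l) \<longlonglongrightarrow> 0"
  \<comment> \<open>The partial sums here include index n, hence the primed
    \<open>summable_iff_convergent'\<close>, stated for \<open>{..n}\<close>;
    \<open>atLeast0AtMost\<close> turns \<open>{0..n}\<close> into that form.\<close>
  using assms by (intro summable_LIMSEQ_zero) (simp add: summable_iff_convergent' atLeast0AtMost)

end
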